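(* Let $\mathcal S\subseteq\mathcal W$ be an arbitrary subset. The following statements are equivalent: (i) There is $c_0\in\mathcal A$ such that $\operatorname{occ}(w)=c_0$ for every $w\in\mathcal S$. (ii) Every occupation-based constraint is rectangular on $\mathcal A\times\mathcal S$.
   Context: $Q_3$ is the $1$-skeleton (graph) of the three-dimensional cube, with vertex set $V=\{0,1\}^3$ and coordinates numbered $0,1,2$; two vertices are adjacent iff they differ in exactly one coordinate. The basepoint is $o=000$. A walk is $w=(o;a_1a_2\cdots a_n)$ with $n\ge0$, $a_k\in\{0,1,2\}$; its vertex sequence is $v_0=o,v_1,\ldots,v_n$, where $v_k$ is obtained from $v_{k-1}$ by flipping coordinate $a_k$. It is closed if $v_n=o$. $\mathcal W$ is the set (monoid under concatenation) of all based closed walks. $\mathcal A=\mathbb Z^V$ is the group of integer-valued functions on $V$, and $\mathcal U=\mathcal A\times\mathcal W$. For $w\in\mathcal W$ with vertex sequence $(v_0,\ldots,v_n)$, $\operatorname{occ}(w)\in\mathcal A$ is defined by $\operatorname{occ}(w)(p)=\#\{k:0\le k<n,\ v_k=p\}$. A constraint is a subset $P\subseteq\mathcal U$. It is occupation-based if there is a predicate $\Psi:\mathcal A\times\mathcal A\to\{\mathrm{false},\mathrm{true}\}$ with $(\alpha,w)\in P\iff\Psi(\alpha,\operatorname{occ}(w))$ for all $(\alpha,w)\in\mathcal U$. It is rectangular on $\mathcal A\times\mathcal S$ if $P\cap(\mathcal A\times\mathcal S)=P_{\mathcal A}\times P_{\mathcal S}$ for some $P_{\mathcal A}\subseteq\mathcal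 A$ and $P_{\mathcal S}\subseteq\mathcal S$. *)

theory Defs
  imports "HOL-Library.Numeral_Type" "HOL-Library.Z2"
begin

text \<open>
  The type \<^typ>\<open>3\<close> has exactly the elements \<open>0\<close>, \<open>1\<close>, \<open>2\<close>,
  and \<^typ>\<open>bit\<close> is the two-element field on \<open>0\<close>, \<open>1\<close>; so the vertex set
  of the cube is the whole type \<open>3 \<Rightarrow> bit\<close>, and its integer-valued functions
  are the whole type \<open>(3 \<Rightarrow> bit) \<Rightarrow> int\<close>.
\<close>

type_synonym coord = 3
type_synonym vertex = "coord \<Rightarrow> bit"
type_synonym vfun = "vertex \<Rightarrow> int"

definition basepoint :: vertex where
  "basepoint = (\<lambda>_. 0)"

definition flip :: "coord \<Rightarrow> vertex \<Rightarrow> vertex" where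
  "flip a v = v(a := v a + 1)"

text \<open>
  A walk from the basepoint is represented by its list of flipped coordinates.
  List positions are counted from \<open>0\<close>, so the step from \<open>v\<^sub>k\<close> to
  \<open>v\<^sub>k\<^sub>+\<^sub>1\<close> flips \<open>w ! k\<close>. The value \<open>vert w k\<close>
  is only meaningful for \<open>k \<le> length w\<close>.
\<close>

type_synonym walk = "coord list"

primrec vert :: "walk \<Rightarrow> nat \<Rightarrow> vertex" where
  "vert w 0 = basepoint"
| "vert w (Suc k) = flip (w ! k) (vert w k)"

definition closed_walks :: "walk set" where
  "closed_walks = {w. vert w (length w) = basepoint}"

definition universe :: "(vfun \<times> walk) set" where
  "universe = UNIV \<times> closed_walks"

definition occ :: "walk \<Rightarrow> vfun" where
  "occ w p = int (card {k. k < length w \<and> vert w k = p})"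

definition occupation_based :: "(vfun \<times> walk) set \<Rightarrow> bool" where
  "occupation_based P \<longleftrightarrow>
     (\<exists>\<Psi> :: vfun \<Rightarrow> vfun \<Rightarrow> bool. \<forall>(\<alpha>, w) \<in> universe. (\<alpha>, w) \<in> P \<longleftrightarrow> \<Psi> \<alpha> (occ w))"

definition rectangular_on :: "walk set \<Rightarrow> (vfun \<times> walk) set \<Rightarrow> bool" where
  "rectangular_on S P \<longleftrightarrow>
     (\<exists>PA PS. PS \<subseteq> S \<and> P \<inter> (UNIV \<times> S) = PA \<times> PS)"

end

theory Submission
  imports Defs
begin

text \<open>
  If \<open>occ\<close> is constant on \<open>S\<close>, then on \<open>UNIV \<times> S\<close> an occupation-based constraint
  depends only on its first argument, so it is a rectangle whose second side is all of \<open>S\<close>.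
  Conversely, a single constraint detects whether \<open>occ\<close> is constant on \<open>S\<close>: the graph
  \<open>\<alpha> = occ w\<close>. A rectangle containing \<open>(occ w, w)\<close> and \<open>(occ w', w')\<close>
  also contains \<open>(occ w, w')\<close>, which lies on the graph only if \<open>occ w = occ w'\<close>.
\<close>

lemma rectangular_on_if_occ_constant:
  assumes "S \<subseteq> closed_walks" and const: "\<And>w. w \<in> S \<Longrightarrow> occ w = c0"
    and "occupation_based P"
  shows "rectangular_on S P"
proof -
  obtain \<Psi> where \<Psi>: "\<And>\<alpha> w. w \<in> closed_walks \<Longrightarrow> (\<alpha>, w) \<in> P \<longleftrightarrow> \<Psi> \<alpha> (occ w)"
    using assms(3) unfolding occupation_based_def universe_def by auto
  have "P \<inter> (UNIV \<times> S) = {\<alpha>. \<Psi> \<alpha> c0} \<times> S"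
    using assms(1) const \<Psi> by auto
  then show ?thesis
    unfolding rectangular_on_def by blast
qed

text \<open>The graph of \<open>occ\<close> on closed walks, with the value written first so that it is a constraint.\<close>

definition occ_graph :: "(vfun \<times> walk) set" where
  "occ_graph = {(\<alpha>, w) \<in> universe. \<alpha> = occ w}"

lemma occupation_based_occ_graph: "occupation_based occ_graph"
  unfolding occupation_based_def occ_graph_def
  by (rule exI[of _ "(=)"]) auto

lemma occ_eq_if_rectangular_on_occ_graph:
  assumes "S \<subseteq> closed_walks" and "rectangular_on S occ_graph"
    and "w \<in> S" and "w' \<in> S"
  shows "occ w = occ w'"
proof -
  obtain PA PS where rect: "occ_graph \<inter> (UNIV \<times> S) = PA \<times> PS"
    using assms(2) unfolding rectangular_on_def by blast
  have "(occ v, v) \<in> PA \<times> PS" if "v \<in> S" for v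
    using that assms(1) unfolding rect[symmetric] occ_graph_def universe_def by auto
  then have "(occ w, w') \<in> PA \<times> PS"
    using assms(3,4) by blast
  then show ?thesis
    unfolding rect[symmetric] occ_graph_def by simp
qed

theorem theorem8p4:
  fixes S :: "walk set"
  assumes "S \<subseteq> closed_walks"
  shows "(\<exists>c0 :: vfun. \<forall>w\<in>S. occ w = c0) \<longleftrightarrow>
    (\<forall>P. P \<subseteq> universe \<and> occupation_based P \<longrightarrow> rectangular_on S P)"
proof
  assume "\<exists>c0 :: vfun. \<forall>w\<in>S. occ w = c0"
  then show "\<forall>P. P \<subseteq> universe \<and> occupation_based P \<longrightarrow> rectangular_on S P"
    using rectangular_on_if_occ_constant[OF assms] by blast
next
  assume "\<forall>P. P \<subseteq> universe \<and> occupation_based P \<longrightarrow> rectangular_on S P"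
  moreover have "occ_graph \<subseteq> universe"
    unfolding occ_graph_def by auto
  ultimately have "rectangular_on S occ_graph"
    using occupation_based_occ_graph by blast
  then show "\<exists>c0 :: vfun. \<forall>w\<in>S. occ w = c0"
    using occ_eq_if_rectangular_on_occ_graph[OF assms] by blast
qed

end
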